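(* Let $G$ be a finite simple graph on $n$ vertices with independence number $\alpha(G)=2$ and clique covering number at most $3$ (i.e., $V(G)$ can be partitioned into at most three cliques of $G$). If $\Delta(G) < 2n/3 - 1$, then $G$ contains a strong immersion of $K_{\chi(G)}$.
   Context: All graphs are finite and simple; $\Delta(G)$ is the maximum degree and $\chi(G)$ the chromatic number. An immersion of a graph $H$ in a graph $G$ is a minimal subgraph $I$ of $G$ for which there is an injection $\mathrm{i}\colon V(H)\to V(I)$ and a set of pairwise edge-disjoint paths $\{P_e : e\in E(H)\}$ in $I$ such that the end vertices of $P_{uv}$ are precisely $\mathrm{i}(u)$ and $\mathrm{i}(v)$. The vertices in the image of $\mathrm{i}$ are the branch vertices. The immersion is strong if no internal vertex of any path $P_e$ is a branch vertex. *)

theory Defs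
  imports Complex_Main "HOL-Library.Disjoint_Sets"
begin

record 'a sgraph =
  verts :: "'a set"
  edges :: "'a set set"

definition simple_graph :: "'a sgraph \<Rightarrow> bool" where
  "simple_graph G \<longleftrightarrow> finite (verts G) \<and> (\<forall>e\<in>edges G. e \<subseteq> verts G \<and> card e = 2)"

definition subgraph :: "'a sgraph \<Rightarrow> 'a sgraph \<Rightarrow> bool" where
  "subgraph H G \<longleftrightarrow> simple_graph H \<and> verts H \<subseteq> verts G \<and> edges H \<subseteq> edges G"

definition complete_graph :: "nat \<Rightarrow> nat sgraph" where
  "complete_graph t = \<lparr>verts = {..<t}, edges = {e. e \<subseteq> {..<t} \<and> card e = 2}\<rparr>"

definition degree :: "'a sgraph \<Rightarrow> 'a \<Rightarrow> nat" where
  "degree G v = card {e\<in>edges G. v \<in> e}"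

text \<open>\<open>Max\<close> is unspecified on the empty set, so this is meaningful only for graphs with at
  least one vertex.\<close>

definition max_degree :: "'a sgraph \<Rightarrow> nat" where
  "max_degree G = Max (degree G ` verts G)"

definition independent :: "'a sgraph \<Rightarrow> 'a set \<Rightarrow> bool" where
  "independent G S \<longleftrightarrow> S \<subseteq> verts G \<and> (\<forall>u\<in>S. \<forall>v\<in>S. {u, v} \<notin> edges G)"

definition independence_number :: "'a sgraph \<Rightarrow> nat" where
  "independence_number G = Max {card S | S. independent G S}"

definition clique :: "'a sgraph \<Rightarrow> 'a set \<Rightarrow> bool" where
  "clique G S \<longleftrightarrow> S \<subseteq> verts G \<and> (\<forall>u\<in>S. \<forall>v\<in>S. u \<noteq> v \<longrightarrow> {u, v} \<in> edges G)"

definition clique_covering_number :: "'a sgraph \<Rightarrow> nat" where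
  "clique_covering_number G =
     (LEAST k. \<exists>\<C>. partition_on (verts G) \<C> \<and> (\<forall>C\<in>\<C>. clique G C) \<and> card \<C> = k)"

definition proper_coloring :: "'a sgraph \<Rightarrow> nat \<Rightarrow> ('a \<Rightarrow> nat) \<Rightarrow> bool" where
  "proper_coloring G k c \<longleftrightarrow>
     c ` verts G \<subseteq> {..<k} \<and> (\<forall>u v. {u, v} \<in> edges G \<longrightarrow> c u \<noteq> c v)"

definition chromatic_number :: "'a sgraph \<Rightarrow> nat" where
  "chromatic_number G = (LEAST k. \<exists>c. proper_coloring G k c)"

text \<open>Paths are given by their nonempty, repetition-free sequences of vertices.\<close>

definition path_edges :: "'a list \<Rightarrow> 'a set set" where
  "path_edges p = {{p ! k, p ! Suc k} | k. Suc k < length p}"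

definition path_in :: "'a sgraph \<Rightarrow> 'a list \<Rightarrow> bool" where
  "path_in G p \<longleftrightarrow> p \<noteq> [] \<and> distinct p \<and> set p \<subseteq> verts G \<and> path_edges p \<subseteq> edges G"

definition internal_vertices :: "'a list \<Rightarrow> 'a set" where
  "internal_vertices p = set p - {hd p, last p}"

text \<open>The end vertices of the path for an edge \<open>e = {u, v}\<close> of \<open>H\<close> form the set \<open>\<iota> ` e\<close>, i.e.
  they are \<open>\<iota> u\<close> and \<open>\<iota> v\<close>; the direction in which the path is listed is irrelevant.\<close>

definition immersion_model ::
    "'b sgraph \<Rightarrow> 'a sgraph \<Rightarrow> ('b \<Rightarrow> 'a) \<Rightarrow> ('b set \<Rightarrow> 'a list) \<Rightarrow> bool" where
  "immersion_model H I \<iota> P \<longleftrightarrow>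
     inj_on \<iota> (verts H) \<and> \<iota> ` verts H \<subseteq> verts I \<and>
     (\<forall>e\<in>edges H. path_in I (P e) \<and> {hd (P e), last (P e)} = \<iota> ` e) \<and>
     disjoint_family_on (\<lambda>e. path_edges (P e)) (edges H)"

text \<open>The branch vertices and the paths are part of the data of an immersion, and \<open>I\<close> is a
  minimal subgraph carrying these data. Were \<open>\<iota>\<close> and \<open>P\<close> allowed to vary in the minimality
  condition, a subgraph with a strong model could be discarded because a proper subgraph of it
  has some other, non-strong model.\<close>

definition immersion ::
    "'b sgraph \<Rightarrow> 'a sgraph \<Rightarrow> 'a sgraph \<Rightarrow> ('b \<Rightarrow> 'a) \<Rightarrow> ('b set \<Rightarrow> 'a list) \<Rightarrow> bool" where
  "immersion H G I \<iota> P \<longleftrightarrow>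
     subgraph I G \<and> immersion_model H I \<iota> P \<and>
     (\<forall>J. subgraph J I \<and> immersion_model H J \<iota> P \<longrightarrow> J = I)"

definition strong_immersion ::
    "'b sgraph \<Rightarrow> 'a sgraph \<Rightarrow> 'a sgraph \<Rightarrow> ('b \<Rightarrow> 'a) \<Rightarrow> ('b set \<Rightarrow> 'a list) \<Rightarrow> bool" where
  "strong_immersion H G I \<iota> P \<longleftrightarrow>
     immersion H G I \<iota> P \<and> (\<forall>e\<in>edges H. internal_vertices (P e) \<inter> \<iota> ` verts H = {})"

definition contains_strong_immersion :: "'a sgraph \<Rightarrow> 'b sgraph \<Rightarrow> bool" where
  "contains_strong_immersion G H \<longleftrightarrow> (\<exists>I \<iota> P. strong_immersion H G I \<iota> P)"

end

theory Submission
  imports Defs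
begin

text \<open>
  Let \<open>H\<close> be the complement of \<open>G\<close>: it is triangle-free, has minimum degree greater than \<open>n/3\<close>
  and is 3-colourable. Let \<open>\<alpha>\<close> be the largest size of a stable set of \<open>H\<close>. Hall's theorem gives a
  matching of \<open>H\<close> with \<open>min \<alpha> (n - \<alpha>)\<close> edges, hence \<open>\<chi>(G) \<le> max \<alpha> (n - \<alpha>)\<close>. If \<open>\<alpha> \<ge> n/2\<close>, a
  clique of \<open>G\<close> suffices. Otherwise it is enough to immerse a complete graph on \<open>n - \<alpha>\<close> vertices.

  Choose a partition of the vertices into stable sets \<open>A\<close>, \<open>B\<close>, \<open>C\<close> of \<open>H\<close> with \<open>C\<close> as large as
  possible, and enlarge \<open>H\<close> to a maximal tripartite triangle-free graph with these parts. The degree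
  condition forbids an induced \<open>2K\<^sub>2\<close> between \<open>B\<close> and \<open>C\<close>, so the sets \<open>C \<inter> N(y)\<close>, for \<open>y \<in> B\<close>, form a
  chain; since \<open>N(y)\<close> is itself a part of some partition into three stable sets, \<open>|N(y)| \<le> |C|\<close>.
  The branch vertices are \<open>A \<union> Y\<close>, where \<open>Y \<subseteq> B\<close> has a matching \<open>g\<close> into \<open>C\<close>. A nonadjacent
  pair \<open>x \<in> A\<close>, \<open>y \<in> Y\<close> is joined by the path \<open>x, g y, u, y\<close> with \<open>u = \<phi> y x \<in> C - N(y)\<close>; there are
  enough such \<open>u\<close> because \<open>|A \<inter> N(y)| + |C \<inter> N(y)| \<le> |C|\<close>, and the chain property makes the middle
  edges of these paths distinct.
\<close>

subsection \<open>Systems of distinct representatives\<close>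

text \<open>Induction on \<open>X\<close>. If some nonempty proper subset \<open>J\<close> is tight,
  it is matched inside its own neighbourhood and the remaining elements are matched outside that
  neighbourhood. Otherwise every nonempty proper subset has a spare neighbour, so one arbitrary
  choice can be fixed and its value deleted.\<close>

lemma hall_marriage:
  fixes N :: "'a \<Rightarrow> 'b set"
  assumes "finite X" and "\<And>x. x \<in> X \<Longrightarrow> finite (N x)"
    and "\<And>J. J \<subseteq> X \<Longrightarrow> card J \<le> card (\<Union>(N ` J))"
  shows "\<exists>g. inj_on g X \<and> (\<forall>x\<in>X. g x \<in> N x)"
  using assms
proof (induction X arbitrary: N rule: finite_psubset_induct)
  case (psubset X)
  note fin = psubset.prems(1) and hall_cond = psubset.prems(2)
  have finU: "finite (\<Union>(N ` J))" if "J \<subseteq> X" for J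
    using fin that psubset.hyps finite_subset by blast
  show ?case
  proof (cases "\<exists>J. J \<subset> X \<and> J \<noteq> {} \<and> card (\<Union>(N ` J)) \<le> card J")
    case True
    then obtain J where J: "J \<subset> X" "J \<noteq> {}" "card (\<Union>(N ` J)) \<le> card J" by blast
    have finJ: "finite J" using J psubset.hyps finite_subset by blast
    have "\<exists>g. inj_on g J \<and> (\<forall>x\<in>J. g x \<in> N x)"
      using J by (intro psubset.IH[OF J(1)] fin hall_cond) auto
    then obtain g where g: "inj_on g J" "\<forall>x\<in>J. g x \<in> N x" by blast
    let ?M = "\<lambda>x. N x - \<Union>(N ` J)"
    \<comment> \<open>Hall's condition for \<open>J \<union> L\<close>, minus the tight count for
      \<open>J\<close>, leaves at least \<open>card L\<close> values outside the neighbourhood of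
      \<open>J\<close>.\<close>
    have "card L \<le> card (\<Union>(?M ` L))" if L: "L \<subseteq> X - J" for L
    proof -
      have finL: "finite L" using L psubset.hyps finite_subset by blast
      have "card J + card L = card (J \<union> L)"
        using L finJ finL by (subst card_Un_disjoint) auto
      also have "\<dots> \<le> card (\<Union>(N ` (J \<union> L)))" using hall_cond L J by blast
      also have "\<Union>(N ` (J \<union> L)) = \<Union>(N ` J) \<union> \<Union>(?M ` L)" by auto
      also have "card \<dots> \<le> card (\<Union>(N ` J)) + card (\<Union>(?M ` L))" by (rule card_Un_le)
      finally show ?thesis using J by linarith
    qed
    moreover have "X - J \<subset> X" using J by blast
    ultimately have "\<exists>h. inj_on h (X - J) \<and> (\<forall>x\<in>X - J. h x \<in> ?M x)"
      by (intro psubset.IH) (auto simp: fin)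
    then obtain h where h: "inj_on h (X - J)" "\<forall>x\<in>X - J. h x \<in> ?M x" by blast
    let ?f = "\<lambda>x. if x \<in> J then g x else h x"
    have "inj_on ?f X"
    proof (rule inj_onI)
      fix a b assume ab: "a \<in> X" "b \<in> X" "?f a = ?f b"
      have sep: "g c \<noteq> h d" if "c \<in> J" "d \<in> X" "d \<notin> J" for c d
        using g(2) h(2) that by fastforce
      show "a = b"
      proof (cases "a \<in> J"; cases "b \<in> J")
        assume "a \<in> J" "b \<in> J"
        then show ?thesis using ab g(1) by (simp add: inj_on_eq_iff)
      next
        assume "a \<in> J" "b \<notin> J"
        then show ?thesis using ab sep[of a b] by simp
      next
        assume "a \<notin> J" "b \<in> J"
        then show ?thesis using ab sep[of b a] by (simp add: eq_commute)
      next
        assume "a \<notin> J" "b \<notin> J"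
        then show ?thesis using ab h(1) by (simp add: inj_on_eq_iff)
      qed
    qed
    moreover have "\<forall>x\<in>X. ?f x \<in> N x" using g h by auto
    ultimately show ?thesis by (intro exI[of _ ?f]) blast
  next
    case no_tight: False
    show ?thesis
    proof (cases "X = {}")
      case False
      then obtain x where x: "x \<in> X" by blast
      have "N x \<noteq> {}" using hall_cond[of "{x}"] x by auto
      then obtain y where y: "y \<in> N x" by blast
      let ?M = "\<lambda>z. N z - {y}"
      have "card L \<le> card (\<Union>(?M ` L))" if L: "L \<subseteq> X - {x}" for L
      proof (cases "L = {}")
        case False
        moreover have "L \<subset> X" using L x by blast
        ultimately have "card L < card (\<Union>(N ` L))" using no_tight by (meson not_le)
        moreover have "\<Union>(?M ` L) = \<Union>(N ` L) - {y}" by auto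
        moreover have "card (\<Union>(N ` L)) - 1 \<le> card (\<Union>(N ` L) - {y})"
          by (simp add: card_Diff_singleton_if)
        ultimately show ?thesis by simp
      qed simp
      moreover have "X - {x} \<subset> X" using x by blast
      ultimately have "\<exists>g. inj_on g (X - {x}) \<and> (\<forall>z\<in>X - {x}. g z \<in> ?M z)"
        by (intro psubset.IH) (auto simp: fin)
      then obtain g where g: "inj_on g (X - {x})" "\<forall>z\<in>X - {x}. g z \<in> ?M z" by blast
      let ?f = "g(x := y)"
      have "inj_on ?f X" using g unfolding inj_on_def by auto
      moreover have "\<forall>z\<in>X. ?f z \<in> N z" using g y by auto
      ultimately show ?thesis by blast
    qed simp
  qed
qed

text \<open>Offering \<open>d\<close> dummy values to every element restores Hall's condition. An
  injective choice spends each dummy at most once, so at most \<open>d\<close> elements miss a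
  genuine value; the others form \<open>Y\<close>.\<close>

lemma hall_deficiency:
  fixes N :: "'a \<Rightarrow> 'b set"
  assumes "finite X" and "\<And>x. x \<in> X \<Longrightarrow> finite (N x)"
    and cond: "\<And>J. J \<subseteq> X \<Longrightarrow> card J \<le> card (\<Union>(N ` J)) + d"
  shows "\<exists>Y g. Y \<subseteq> X \<and> card X \<le> card Y + d \<and> inj_on g Y \<and> (\<forall>y\<in>Y. g y \<in> N y)"
proof -
  define M :: "'a \<Rightarrow> ('b + nat) set" where "M x = Inl ` N x \<union> Inr ` {..<d}" for x
  have "card J \<le> card (\<Union>(M ` J))" if J: "J \<subseteq> X" for J
  proof (cases "J = {}")
    case False
    then have "\<Union>(M ` J) = Inl ` \<Union>(N ` J) \<union> Inr ` {..<d}" unfolding M_def by auto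
    moreover have "finite (\<Union>(N ` J))" using assms J by (meson finite_UN_I finite_subset subsetD)
    ultimately have "card (\<Union>(M ` J)) =
        card (Inl ` \<Union>(N ` J) :: ('b + nat) set) + card (Inr ` {..<d} :: ('b + nat) set)"
      by (simp only:) (intro card_Un_disjoint, auto)
    then show ?thesis using cond[OF J] by (simp add: card_image)
  qed simp
  then have "\<exists>f. inj_on f X \<and> (\<forall>x\<in>X. f x \<in> M x)"
    using assms by (intro hall_marriage) (auto simp: M_def)
  then obtain f where f: "inj_on f X" "\<forall>x\<in>X. f x \<in> M x" by blast
  define Y where "Y = {x \<in> X. isl (f x)}"
  have "f ` (X - Y) \<subseteq> Inr ` {..<d}" using f unfolding Y_def M_def by auto
  then have "card (f ` (X - Y)) \<le> card (Inr ` {..<d} :: ('b + nat) set)" by (intro card_mono) auto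
  also have "\<dots> = d" by (simp add: card_image)
  finally have "card (X - Y) \<le> d" using f by (simp add: card_image inj_on_diff)
  moreover have "card (X - Y) = card X - card Y"
    using assms(1) unfolding Y_def by (intro card_Diff_subset) auto
  ultimately have "card X \<le> card Y + d" by simp
  moreover have "inj_on (projl \<circ> f) Y"
  proof (rule inj_onI)
    fix a b assume "a \<in> Y" "b \<in> Y" "(projl \<circ> f) a = (projl \<circ> f) b"
    then have "f a = f b" unfolding Y_def by (metis (mono_tags, lifting) comp_apply mem_Collect_eq sum.collapse(1))
    then show "a = b" using f \<open>a \<in> Y\<close> \<open>b \<in> Y\<close> unfolding Y_def inj_on_def by blast
  qed
  moreover have "\<forall>y\<in>Y. (projl \<circ> f) y \<in> N y" using f unfolding Y_def M_def by auto
  moreover have "Y \<subseteq> X" unfolding Y_def by blast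
  ultimately show ?thesis by blast
qed

subsection \<open>Dense triangle-free graphs\<close>

definition stable :: "('a \<times> 'a) set \<Rightarrow> 'a set \<Rightarrow> bool" where
  "stable E X \<longleftrightarrow> (\<forall>x\<in>X. \<forall>y\<in>X. (x, y) \<notin> E)"

lemma stable_mono: "stable E X \<Longrightarrow> Y \<subseteq> X \<Longrightarrow> stable E Y"
  unfolding stable_def by blast

text \<open>The vertices need not be distinct: the case \<open>x = y = z\<close> excludes loops as
  well.\<close>

definition triangle_free :: "('a \<times> 'a) set \<Rightarrow> bool" where
  "triangle_free E \<longleftrightarrow> (\<forall>x y z. (x, y) \<in> E \<longrightarrow> (y, z) \<in> E \<longrightarrow> (x, z) \<notin> E)"

definition tripartition :: "('a \<times> 'a) set \<Rightarrow> 'a set \<Rightarrow> 'a set \<Rightarrow> 'a set \<Rightarrow> 'a set \<Rightarrow> bool" where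
  "tripartition E V A B C \<longleftrightarrow> A \<union> B \<union> C = V \<and> A \<inter> B = {} \<and> A \<inter> C = {} \<and> B \<inter> C = {} \<and>
     stable E A \<and> stable E B \<and> stable E C"

text \<open>Edges are ordered pairs, so that neighbourhoods are relational images. The locale serves
  for the complement of \<open>G\<close> and again for its tripartite enlargement, since adding
  edges only raises degrees.\<close>

locale dense_triangle_free =
  fixes V :: "'a set" and E :: "('a \<times> 'a) set"
  assumes finite_V: "finite V"
    and E_subset: "E \<subseteq> V \<times> V"
    and sym_E: "sym E"
    and triangle_free_E: "triangle_free E"
    and dense: "v \<in> V \<Longrightarrow> card V < 3 * card (E `` {v})"
begin

lemma nbrs_subset: "E `` {v} \<subseteq> V"
  using E_subset by blast

lemma finite_nbrs: "finite (E `` {v})"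
  using nbrs_subset finite_V finite_subset by metis

lemma edge_sym: "(x, y) \<in> E \<Longrightarrow> (y, x) \<in> E"
  using sym_E by (rule symD)

lemma no_triangle: "(x, y) \<in> E \<Longrightarrow> (y, z) \<in> E \<Longrightarrow> (x, z) \<notin> E"
  using triangle_free_E unfolding triangle_free_def by blast

lemma nbrs_disjoint: "(x, y) \<in> E \<Longrightarrow> E `` {x} \<inter> E `` {y} = {}"
  using no_triangle edge_sym by blast

lemma stable_nbrs: "stable E (E `` {v})"
  using no_triangle edge_sym unfolding stable_def by blast

lemma stable_Un:
  assumes "stable E X" "stable E Y" "\<And>x y. x \<in> X \<Longrightarrow> y \<in> Y \<Longrightarrow> (x, y) \<notin> E"
  shows "stable E (X \<union> Y)"
  unfolding stable_def
proof (intro ballI)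
  fix x y assume "x \<in> X \<union> Y" "y \<in> X \<union> Y"
  then show "(x, y) \<notin> E"
    using assms(1,2) assms(3)[of x y] assms(3)[of y x] edge_sym[of x y] unfolding stable_def by auto
qed

text \<open>Adjacent vertices have disjoint neighbourhoods, so no element of \<open>X\<close> is
  counted twice.\<close>

lemma card_edge_le:
  assumes "(x, y) \<in> E" "finite X"
  shows "card (X \<inter> E `` {x}) + card (X \<inter> E `` {y}) \<le> card X"
proof -
  have "card (X \<inter> E `` {x}) + card (X \<inter> E `` {y}) = card ((X \<inter> E `` {x}) \<union> (X \<inter> E `` {y}))"
    using assms nbrs_disjoint[OF assms(1)] by (subst card_Un_disjoint) auto
  also have "\<dots> \<le> card X" using assms by (intro card_mono) auto
  finally show ?thesis .
qed

lemma edge_dense: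
  assumes "(x, y) \<in> E"
  shows "2 * card V < 3 * card (E `` {x} \<union> E `` {y})"
proof -
  have "card (E `` {x} \<union> E `` {y}) = card (E `` {x}) + card (E `` {y})"
    using finite_nbrs nbrs_disjoint[OF assms] by (intro card_Un_disjoint) auto
  then show ?thesis using dense[of x] dense[of y] assms E_subset by auto
qed

text \<open>Suppose \<open>J\<close> violates Hall's condition. It exceeds the neighbourhood of any
  of its vertices, so it has more than a third of all vertices. The set \<open>W\<close> of vertices
  outside \<open>I\<close> and not adjacent to \<open>J\<close> cannot be stable, and an edge inside
  \<open>W\<close> has more than two thirds of all vertices as neighbours, none of them in
  \<open>J\<close>: too many.\<close>

lemma matching_from_maximum_stable:
  assumes I: "I \<subseteq> V" "stable E I" and max: "\<And>J. J \<subseteq> V \<Longrightarrow> stable E J \<Longrightarrow> card J \<le> card I"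
    and le: "2 * card I \<le> card V"
  shows "\<exists>g. inj_on g I \<and> (\<forall>x\<in>I. (x, g x) \<in> E)"
proof -
  have finI: "finite I" using I finite_V finite_subset by blast
  have "card J \<le> card (\<Union>x\<in>J. E `` {x})" if J: "J \<subseteq> I" for J
  proof (rule ccontr)
    assume "\<not> ?thesis"
    then have lt: "card (E `` J) < card J" by (simp add: Image_eq_UN[symmetric])
    then have "J \<noteq> {}" by auto
    have finJ: "finite J" using J finI finite_subset by blast
    obtain x where "x \<in> J" using \<open>J \<noteq> {}\<close> by blast
    have NJ: "E `` J \<subseteq> V" using E_subset by blast
    have "card (E `` {x}) \<le> card (E `` J)"
      using \<open>x \<in> J\<close> NJ finite_V by (intro card_mono) (auto intro: finite_subset)
    then have J_large: "card V < 3 * card J" using dense[of x] \<open>x \<in> J\<close> J I lt by fastforce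
    define W where "W = V - I - E `` J"
    have NJI: "E `` J \<inter> I = {}" using I J unfolding stable_def by blast
    have cW: "card W = card V - card I - card (E `` J)"
      unfolding W_def using I NJI NJ finite_V finI
      by (subst card_Diff_subset) (auto simp: card_Diff_subset intro: finite_subset)
    have finW: "finite W" unfolding W_def using finite_V by blast
    \<comment> \<open>If \<open>W\<close> were stable, so would be \<open>J \<union> W\<close>,
      which has more than \<open>card V - card I\<close> elements and hence more than
      \<open>card I\<close>.\<close>
    have "\<not> stable E W"
    proof
      assume "stable E W"
      moreover have "(x, y) \<notin> E" if "x \<in> J" "y \<in> W" for x y
        using that unfolding W_def by blast
      ultimately have "stable E (J \<union> W)" using stable_Un stable_mono[OF I(2) J] by blast
      then have "card (J \<union> W) \<le> card I" using max[of "J \<union> W"] I J unfolding W_def by blast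
      moreover have "card (J \<union> W) = card J + card W"
        using finJ finW J unfolding W_def by (intro card_Un_disjoint) auto
      ultimately show False using cW lt le by linarith
    qed
    then obtain u v where uv: "u \<in> W" "v \<in> W" "(u, v) \<in> E" unfolding stable_def by blast
    have "E `` {u} \<union> E `` {v} \<subseteq> V - J"
      using uv E_subset edge_sym unfolding W_def by blast
    then have "card (E `` {u} \<union> E `` {v}) \<le> card (V - J)"
      using finite_V by (intro card_mono) auto
    also have "\<dots> = card V - card J" using J I finJ by (intro card_Diff_subset) auto
    finally show False using edge_dense[OF uv(3)] J_large by linarith
  qed
  then have "\<exists>g. inj_on g I \<and> (\<forall>x\<in>I. g x \<in> E `` {x})"
    using finI finite_nbrs by (intro hall_marriage)
  then show ?thesis by simp
qed

text \<open>Suppose \<open>J\<close> violates Hall's condition, and let \<open>M\<close> be its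
  neighbourhood in \<open>I\<close>. Exchanging \<open>M\<close> for \<open>J\<close> would enlarge
  \<open>I\<close> if \<open>J\<close> were stable, so \<open>J\<close> contains an edge, whose ends
  force \<open>M\<close> to be large. On the other hand, a vertex of \<open>I - M\<close> has all
  its neighbours outside \<open>I\<close> and \<open>J\<close>, which forces \<open>J\<close> to be
  small.\<close>

lemma matching_into_maximum_stable:
  assumes I: "I \<subseteq> V" "stable E I" and max: "\<And>J. J \<subseteq> V \<Longrightarrow> stable E J \<Longrightarrow> card J \<le> card I"
    and ge: "card V \<le> 2 * card I"
  shows "\<exists>g. inj_on g (V - I) \<and> (\<forall>x\<in>V - I. g x \<in> I \<and> (x, g x) \<in> E)"
proof -
  have finI: "finite I" using I finite_V finite_subset by blast
  have cI: "card I \<le> card V" using I finite_V card_mono by blast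
  define d where "d = card (V - I)"
  have cVI: "d + card I = card V" unfolding d_def using I finI cI by (simp add: card_Diff_subset)
  have "card J \<le> card (\<Union>x\<in>J. I \<inter> E `` {x})" if J: "J \<subseteq> V - I" for J
  proof (rule ccontr)
    define M where "M = I \<inter> E `` J"
    have "(\<Union>x\<in>J. I \<inter> E `` {x}) = M" unfolding M_def by blast
    moreover assume "\<not> ?thesis"
    ultimately have lt: "card M < card J" by simp
    have finJ: "finite J" using J finite_V finite_subset by blast
    have MI: "M \<subseteq> I" unfolding M_def by blast
    have finM: "finite M" using MI finI finite_subset by blast
    have cJ: "card J \<le> d" unfolding d_def using J finite_V by (intro card_mono) auto
    have "\<not> stable E J"
    proof
      assume "stable E J"
      moreover have "(x, y) \<notin> E" if "x \<in> J" "y \<in> I - M" for x y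
        using that unfolding M_def by blast
      moreover have "stable E (I - M)" using I(2) by (rule stable_mono) blast
      ultimately have "stable E (J \<union> (I - M))" using stable_Un by blast
      then have "card (J \<union> (I - M)) \<le> card I" using max[of "J \<union> (I - M)"] I J by blast
      moreover have "card (J \<union> (I - M)) = card J + (card I - card M)"
        using finJ finI J MI finM by (subst card_Un_disjoint) (auto simp: card_Diff_subset)
      moreover have "card M \<le> card I" using MI finI card_mono by blast
      ultimately show False using lt by linarith
    qed
    then obtain u v where uv: "u \<in> J" "v \<in> J" "(u, v) \<in> E" unfolding stable_def by blast
    have "E `` {u} \<union> E `` {v} \<subseteq> M \<union> (V - I)"
      using uv E_subset unfolding M_def by blast
    then have "card (E `` {u} \<union> E `` {v}) \<le> card M + d"
      unfolding d_def using finM finite_V card_mono[of "M \<union> (V - I)"] card_Un_le[of M "V - I"]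
      by (metis finite_Diff finite_UnI order_trans)
    then have M_large: "2 * card V < 3 * (card M + d)"
      using edge_dense[OF uv(3)] by arith
    have "card M < card I" using lt cJ ge cVI by linarith
    then have "M \<noteq> I" by blast
    then obtain x where x: "x \<in> I" "x \<notin> M" using MI by blast
    have "E `` {x} \<subseteq> (V - I) - J"
      using x E_subset edge_sym I unfolding M_def stable_def by blast
    then have "card (E `` {x}) \<le> card ((V - I) - J)" using finite_V by (intro card_mono) auto
    also have "\<dots> = d - card J" using J finJ unfolding d_def by (simp add: card_Diff_subset)
    finally have "card V < 3 * (d - card J)" using dense[of x] x I by fastforce
    \<comment> \<open>Adding the two density bounds and using \<open>card M < card J\<close> gives
      \<open>card V < 2 * d\<close>, but \<open>d\<close> is at most half of
      \<open>card V\<close>.\<close>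
    then have "card V + 3 * card J < 3 * d" using cJ by simp
    moreover have "2 * card V < 3 * card M + 3 * d" using M_large by simp
    ultimately show False using lt cVI ge by linarith
  qed
  then have "\<exists>g. inj_on g (V - I) \<and> (\<forall>x\<in>V - I. g x \<in> I \<inter> E `` {x})"
    using finite_V finI by (intro hall_marriage) auto
  then show ?thesis by auto
qed

end

subsection \<open>Saturated tripartite graphs\<close>

text \<open>Take an inclusion-maximal graph among the finitely many admissible ones. If a
  nonadjacent pair in question had no common neighbour, adding it as an edge would create no
  triangle and respect the parts.\<close>

lemma saturated_extension:
  assumes "finite V" and E: "E \<subseteq> V \<times> V" "sym E" "triangle_free E" "tripartition E V A B C"
  shows "\<exists>F. E \<subseteq> F \<and> F \<subseteq> V \<times> V \<and> sym F \<and> triangle_free F \<and> tripartition F V A B C \<and>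
    (\<forall>x\<in>B. \<forall>y\<in>A \<union> C. (x, y) \<notin> F \<longrightarrow> (\<exists>z. (x, z) \<in> F \<and> (z, y) \<in> F))"
proof -
  define \<F> where "\<F> = {F. E \<subseteq> F \<and> F \<subseteq> V \<times> V \<and> sym F \<and> triangle_free F \<and> tripartition F V A B C}"
  have "finite \<F>"
  proof (rule finite_subset)
    show "\<F> \<subseteq> Pow (V \<times> V)" unfolding \<F>_def by auto
    show "finite (Pow (V \<times> V))" using \<open>finite V\<close> by simp
  qed
  moreover have "E \<in> \<F>" using E unfolding \<F>_def by blast
  ultimately obtain F where F: "F \<in> \<F>" and max: "\<And>F'. F' \<in> \<F> \<Longrightarrow> F \<subseteq> F' \<Longrightarrow> F = F'"
    using finite_has_maximal2[of \<F> E] by auto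
  have F': "E \<subseteq> F" "F \<subseteq> V \<times> V" "sym F" "triangle_free F" "tripartition F V A B C"
    using F unfolding \<F>_def by auto
  have tfF: "(x, z) \<notin> F" if "(x, y) \<in> F" "(y, z) \<in> F" for x y z
    using F'(4) that unfolding triangle_free_def by blast
  have symF: "(y, x) \<in> F" if "(x, y) \<in> F" for x y
    using F'(3) that by (rule symD)
  have "\<exists>z. (x, z) \<in> F \<and> (z, y) \<in> F" if xy: "x \<in> B" "y \<in> A \<union> C" "(x, y) \<notin> F" for x y
  proof (rule ccontr)
    assume no: "\<nexists>z. (x, z) \<in> F \<and> (z, y) \<in> F"
    define G where "G = insert (x, y) (insert (y, x) F)"
    have sep: "x \<notin> A" "x \<notin> C" "y \<notin> B" "x \<in> V" "y \<in> V" "x \<noteq> y"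
      using xy F'(5) unfolding tripartition_def by auto
    have no_common: "(x, z) \<notin> F \<or> (y, z) \<notin> F" for z
      using no symF by blast
    have irrefl: "(z, z) \<notin> F" for z using tfF by blast
    have sym_G: "(v, u) \<in> G" if "(u, v) \<in> G" for u v
      using that symF unfolding G_def by auto
    have irrefl_G: "(u, u) \<notin> G" for u using irrefl sep unfolding G_def by auto
    have new: "{u, v} = {x, y}" if "(u, v) \<in> G" "(u, v) \<notin> F" for u v
      using that unfolding G_def by auto
    \<comment> \<open>In a triangle of \<open>G\<close> on a new edge the two other edges are old,
      so their common end would be a common neighbour of \<open>x\<close> and \<open>y\<close> in
      \<open>F\<close>.\<close>
    have no_new: False if "{p, q} = {x, y}" "(p, r) \<in> G" "(q, r) \<in> G" for p q r
    proof -
      have "r \<noteq> p" "r \<noteq> q" using that irrefl_G by auto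
      then have "(p, r) \<in> F" "(q, r) \<in> F"
        using that new[of p r] new[of q r] by (auto simp: doubleton_eq_iff)
      then show False using that no_common[of r] by (auto simp: doubleton_eq_iff)
    qed
    have "(p, r) \<notin> G" if "(p, q) \<in> G" "(q, r) \<in> G" for p q r
    proof
      assume pr: "(p, r) \<in> G"
      have "(p, q) \<in> F" using no_new[of p q r] new[of p q] that pr by blast
      moreover have "(q, r) \<in> F" using no_new[of q r p] new[of q r] that pr sym_G by blast
      moreover have "(p, r) \<in> F" using no_new[of p r q] new[of p r] that pr sym_G by blast
      ultimately show False using tfF by blast
    qed
    then have "triangle_free G" unfolding triangle_free_def by blast
    moreover have "sym G" using sym_G by (intro symI)
    moreover have "tripartition G V A B C"
      using F'(5) sep unfolding tripartition_def stable_def G_def by auto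
    moreover have "G \<subseteq> V \<times> V" "E \<subseteq> G" "F \<subseteq> G" using F' sep unfolding G_def by auto
    ultimately have "F = G" by (intro max) (auto simp: \<F>_def)
    then show False using xy unfolding G_def by blast
  qed
  then show ?thesis using F' by (intro exI[of _ F]) auto
qed

locale saturated_tripartite = dense_triangle_free +
  fixes A B C :: "'a set"
  assumes parts: "tripartition E V A B C"
    and saturated: "x \<in> B \<Longrightarrow> y \<in> A \<union> C \<Longrightarrow> (x, y) \<notin> E \<Longrightarrow> \<exists>z. (x, z) \<in> E \<and> (z, y) \<in> E"
begin

lemma stable_parts: "stable E A" "stable E B" "stable E C"
  and V_eq: "V = A \<union> B \<union> C"
  and disjoint_parts: "A \<inter> B = {}" "A \<inter> C = {}" "B \<inter> C = {}"
  using parts unfolding tripartition_def by auto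

lemma finite_parts: "finite A" "finite B" "finite C"
  using V_eq finite_V by auto

lemma card_V: "card V = card A + card B + card C"
proof -
  have "card V = card (A \<union> B) + card C"
    unfolding V_eq using finite_parts disjoint_parts by (intro card_Un_disjoint) auto
  then show ?thesis using finite_parts disjoint_parts by (simp add: card_Un_disjoint)
qed

lemma card_nbrs_split:
  "card (E `` {v}) = card (A \<inter> E `` {v}) + card (B \<inter> E `` {v}) + card (C \<inter> E `` {v})"
proof -
  have "E `` {v} = (A \<inter> E `` {v}) \<union> (B \<inter> E `` {v}) \<union> (C \<inter> E `` {v})"
    using nbrs_subset[of v] V_eq by blast
  moreover have "card ((A \<inter> E `` {v}) \<union> (B \<inter> E `` {v}) \<union> (C \<inter> E `` {v}))
      = card ((A \<inter> E `` {v}) \<union> (B \<inter> E `` {v})) + card (C \<inter> E `` {v})"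
    using finite_parts disjoint_parts by (intro card_Un_disjoint) auto
  moreover have "card ((A \<inter> E `` {v}) \<union> (B \<inter> E `` {v}))
      = card (A \<inter> E `` {v}) + card (B \<inter> E `` {v})"
    using finite_parts disjoint_parts by (intro card_Un_disjoint) auto
  ultimately show ?thesis by metis
qed

lemma own_part_empty:
  "v \<in> A \<Longrightarrow> A \<inter> E `` {v} = {}" "v \<in> B \<Longrightarrow> B \<inter> E `` {v} = {}" "v \<in> C \<Longrightarrow> C \<inter> E `` {v} = {}"
  using stable_parts unfolding stable_def by auto

lemma common_nbr_in_third:
  "x \<in> B \<Longrightarrow> y \<in> C \<Longrightarrow> (x, z) \<in> E \<Longrightarrow> (z, y) \<in> E \<Longrightarrow> z \<in> A"
  "x \<in> B \<Longrightarrow> y \<in> A \<Longrightarrow> (x, z) \<in> E \<Longrightarrow> (z, y) \<in> E \<Longrightarrow> z \<in> C"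
  using stable_parts E_subset V_eq unfolding stable_def by blast+

section \<open>Nested neighbourhoods and routing data in saturated tripartite graphs\<close>

lemma two_K2_free:
  assumes "x \<in> B" "y \<in> B" "u \<in> C" "v \<in> C" "(x, u) \<in> E" "(y, v) \<in> E" "(x, v) \<notin> E"
  shows "(y, u) \<in> E"
proof (rule ccontr)
  text \<open>Otherwise \<open>x, u, a, y, v, b\<close> is a closed walk, and in each part two disjoint edges of it cover the
    four vertices that have neighbours there, so its six degrees add up to at most \<open>2n\<close>.\<close>
  assume "(y, u) \<notin> E"
  then obtain a where a: "(y, a) \<in> E" "(a, u) \<in> E" using saturated assms by blast
  obtain b where b: "(x, b) \<in> E" "(b, v) \<in> E" using saturated assms by blast
  have ab: "a \<in> A" "b \<in> A" using common_nbr_in_third(1) a b assms by blast+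
  note sums = card_edge_le[OF assms(5) finite_parts(1)] card_edge_le[OF assms(6) finite_parts(1)]
    card_edge_le[OF a(2) finite_parts(2)] card_edge_le[OF b(2) finite_parts(2)]
    card_edge_le[OF a(1) finite_parts(3)] card_edge_le[OF b(1) finite_parts(3)]
  have V: "x \<in> V" "y \<in> V" "u \<in> V" "v \<in> V" "a \<in> V" "b \<in> V" using assms ab V_eq by auto
  have "card (E `` {x}) + card (E `` {u}) + card (E `` {y}) + card (E `` {v}) + card (E `` {a})
      + card (E `` {b}) \<le> 2 * card V"
    using sums assms ab own_part_empty card_V by (simp add: card_nbrs_split)
  then show False
    using dense[OF V(1)] dense[OF V(2)] dense[OF V(3)] dense[OF V(4)] dense[OF V(5)] dense[OF V(6)]
    by linarith
qed

text \<open>Private neighbours of \<open>x\<close> and of \<open>y\<close> in \<open>C\<close> would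
  give exactly the two edges excluded by \<open>two_K2_free\<close>.\<close>

lemma nbrs_chain:
  assumes "x \<in> B" "y \<in> B"
  shows "C \<inter> E `` {x} \<subseteq> E `` {y} \<or> C \<inter> E `` {y} \<subseteq> E `` {x}"
proof (rule ccontr)
  assume "\<not> ?thesis"
  then obtain u v where "u \<in> C" "(x, u) \<in> E" "(y, u) \<notin> E" "v \<in> C" "(y, v) \<in> E" "(x, v) \<notin> E"
    by blast
  then show False using two_K2_free[of x y u v] assms by blast
qed

text \<open>The neighbourhood of \<open>y\<close> is stable by triangle-freeness and avoids
  \<open>B\<close>. What is left of \<open>A\<close> and \<open>C\<close> absorbs \<open>B\<close>:
  a vertex of \<open>B\<close> joins \<open>A\<close> if its neighbours in \<open>A\<close> all lie
  in the removed set, and otherwise its neighbours in \<open>C\<close> all lie there, so that it can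
  join \<open>C\<close>.\<close>

lemma tripartition_with_nbrs:
  assumes y: "y \<in> B"
  shows "\<exists>A' B'. tripartition E V A' B' (E `` {y})"
proof -
  let ?N = "E `` {y}"
  define B\<^sub>1 where "B\<^sub>1 = {b \<in> B. A \<inter> E `` {b} \<subseteq> ?N}"
  \<comment> \<open>Saturation yields \<open>z\<close> in \<open>C\<close> adjacent to
    \<open>y\<close> and \<open>a\<close>, hence not to \<open>b\<close>. If \<open>c\<close> were
    not adjacent to \<open>y\<close>, the edges \<open>yz\<close> and \<open>bc\<close> would
    contradict \<open>two_K2_free\<close>.\<close>
  have late: "C \<inter> E `` {b} \<subseteq> ?N" if b: "b \<in> B - B\<^sub>1" for b
  proof
    fix c assume c: "c \<in> C \<inter> E `` {b}"
    obtain a where a: "a \<in> A" "(b, a) \<in> E" "(y, a) \<notin> E" using b unfolding B\<^sub>1_def by blast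
    then obtain z where z: "(y, z) \<in> E" "(z, a) \<in> E" using saturated y by blast
    then have "z \<in> C" using common_nbr_in_third(2) y a by blast
    moreover have "(b, z) \<notin> E" using no_triangle[OF a(2) edge_sym[OF z(2)]] .
    ultimately show "c \<in> ?N" using two_K2_free[of y b z c] y b c z by blast
  qed
  have "stable E ((A - ?N) \<union> B\<^sub>1)"
  proof (rule stable_Un)
    show "stable E (A - ?N)" "stable E B\<^sub>1"
      using stable_parts stable_mono unfolding B\<^sub>1_def by (metis Diff_subset, metis Collect_subset)
    show "(a, b) \<notin> E" if "a \<in> A - ?N" "b \<in> B\<^sub>1" for a b
      using that edge_sym[of a b] unfolding B\<^sub>1_def by auto
  qed
  moreover have "stable E ((C - ?N) \<union> (B - B\<^sub>1))"
  proof (rule stable_Un)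
    show "stable E (C - ?N)" "stable E (B - B\<^sub>1)"
      using stable_parts stable_mono by (metis Diff_subset)+
    show "(c, b) \<notin> E" if "c \<in> C - ?N" "b \<in> B - B\<^sub>1" for c b
      using that late[OF that(2)] edge_sym[of c b] by auto
  qed
  moreover have "?N \<inter> B = {}" using own_part_empty(2)[OF y] by blast
  moreover have "?N \<subseteq> V" by (rule nbrs_subset)
  moreover have "B\<^sub>1 \<subseteq> B" unfolding B\<^sub>1_def by blast
  ultimately have "tripartition E V ((A - ?N) \<union> B\<^sub>1) ((C - ?N) \<union> (B - B\<^sub>1)) ?N"
    using stable_nbrs[of y] V_eq disjoint_parts unfolding tripartition_def by auto
  then show ?thesis by blast
qed

text \<open>Here \<open>s\<close> is the wanted number of branch vertices and \<open>t\<close>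
  bounds the stable sets. The matching \<open>g\<close> comes from Hall's theorem with deficiency
  \<open>t - card C\<close>, and the maps \<open>\<phi> y\<close> from the maximality of
  \<open>C\<close>.\<close>

lemma routing_data:
  assumes C_max: "\<And>A' B' C'. tripartition E V A' B' C' \<Longrightarrow> card C' \<le> card C"
    and stable_le: "\<And>J. J \<subseteq> V \<Longrightarrow> stable E J \<Longrightarrow> card J \<le> t"
    and s: "s + t \<le> card V" "card A \<le> s"
  shows "\<exists>Y g \<phi>. Y \<subseteq> B \<and> card (A \<union> Y) = s \<and> inj_on g Y \<and>
    (\<forall>y\<in>Y. g y \<in> C \<inter> E `` {y}) \<and>
    (\<forall>y\<in>Y. inj_on (\<phi> y) (A \<inter> E `` {y}) \<and> \<phi> y ` (A \<inter> E `` {y}) \<subseteq> C - E `` {y})"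
proof -
  have C_le: "card C \<le> t" using stable_le stable_parts V_eq by blast
  \<comment> \<open>\<open>J\<close> together with the vertices of \<open>C\<close> not adjacent to
    it is stable, hence has at most \<open>t\<close> elements.\<close>
  have "card J \<le> card (\<Union>y\<in>J. C \<inter> E `` {y}) + (t - card C)" if J: "J \<subseteq> B" for J
  proof -
    let ?M = "\<Union>y\<in>J. C \<inter> E `` {y}"
    have "stable E (J \<union> (C - ?M))"
    proof (rule stable_Un)
      show "stable E J" "stable E (C - ?M)"
        using stable_parts stable_mono J by (blast, metis Diff_subset)
    qed auto
    then have "card (J \<union> (C - ?M)) \<le> t" using stable_le[of "J \<union> (C - ?M)"] J V_eq by blast
    moreover have "card (J \<union> (C - ?M)) = card J + card (C - ?M)"
      using J finite_parts disjoint_parts finite_subset[OF J] by (intro card_Un_disjoint) auto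
    moreover have "card (C - ?M) = card C - card ?M"
      using finite_parts finite_subset[of ?M C] by (intro card_Diff_subset) auto
    moreover have "card ?M \<le> card C" using finite_parts by (intro card_mono) auto
    ultimately show ?thesis using C_le by linarith
  qed
  then have "\<exists>Y g. Y \<subseteq> B \<and> card B \<le> card Y + (t - card C) \<and> inj_on g Y \<and> (\<forall>y\<in>Y. g y \<in> C \<inter> E `` {y})"
    using finite_parts by (intro hall_deficiency) auto
  then obtain Y\<^sub>0 g where Y0: "Y\<^sub>0 \<subseteq> B" "card B \<le> card Y\<^sub>0 + (t - card C)"
    and g: "inj_on g Y\<^sub>0" "\<forall>y\<in>Y\<^sub>0. g y \<in> C \<inter> E `` {y}" by blast
  \<comment> \<open>The matched part of \<open>B\<close> has at least
    \<open>card B + card C - t\<close> elements, which is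
    \<open>card V - t - card A\<close>.\<close>
  have "s - card A \<le> card Y\<^sub>0" using Y0 s C_le card_V by linarith
  then obtain Y where Y: "Y \<subseteq> Y\<^sub>0" "card Y = s - card A" "finite Y"
    using obtain_subset_with_card_n by metis
  have "card (A \<union> Y) = card A + card Y"
    using Y Y0 finite_parts disjoint_parts by (intro card_Un_disjoint) blast+
  then have "card (A \<union> Y) = s" using Y s by simp
  have "\<exists>\<phi>. inj_on \<phi> (A \<inter> E `` {y}) \<and> \<phi> ` (A \<inter> E `` {y}) \<subseteq> C - E `` {y}" if "y \<in> Y" for y
  proof -
    have yB: "y \<in> B" using that Y Y0 by blast
    \<comment> \<open>The neighbourhood of \<open>y\<close> is a part of a tripartition, so it is no
      larger than \<open>C\<close>. Its vertices in \<open>A\<close> therefore number at most the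
      vertices of \<open>C\<close> outside it.\<close>
    have "card (E `` {y}) \<le> card C" using tripartition_with_nbrs[OF yB] C_max by blast
    then have "card (A \<inter> E `` {y}) + card (C \<inter> E `` {y}) \<le> card C"
      using card_nbrs_split[of y] own_part_empty(2)[OF yB] by simp
    moreover have "card (C - E `` {y}) = card C - card (C \<inter> E `` {y})"
      using finite_parts by (metis card_Diff_subset_Int finite_Int)
    ultimately have "card (A \<inter> E `` {y}) \<le> card (C - E `` {y})" by linarith
    then show ?thesis
      using card_le_inj[of "A \<inter> E `` {y}" "C - E `` {y}"] finite_parts by auto
  qed
  then have "\<exists>\<phi>. \<forall>y\<in>Y. inj_on (\<phi> y) (A \<inter> E `` {y}) \<and> \<phi> y ` (A \<inter> E `` {y}) \<subseteq> C - E `` {y}"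
    by (intro bchoice) blast
  moreover have "inj_on g Y" "Y \<subseteq> B" "\<forall>y\<in>Y. g y \<in> C \<inter> E `` {y}"
    using g Y Y0 inj_on_subset by (blast, blast, blast)
  ultimately show ?thesis using \<open>card (A \<union> Y) = s\<close> by blast
qed

end

subsection \<open>Strong immersions of complete graphs\<close>

lemma path_edges_two: "path_edges [a, b] = {{a, b}}"
  unfolding path_edges_def by auto

lemma path_edges_four: "path_edges [a, b, c, d] = {{a, b}, {b, c}, {c, d}}"
proof
  show "path_edges [a, b, c, d] \<subseteq> {{a, b}, {b, c}, {c, d}}"
    unfolding path_edges_def by (auto simp: less_Suc_eq)
  show "{{a, b}, {b, c}, {c, d}} \<subseteq> path_edges [a, b, c, d]"
    unfolding path_edges_def by (auto intro: exI[of _ 0] exI[of _ "Suc 0"] exI[of _ "Suc (Suc 0)"])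
qed

lemma path_edges_subset_set: "e \<in> path_edges p \<Longrightarrow> e \<subseteq> set p"
  unfolding path_edges_def by auto

text \<open>Indexing paths by pairs of branch vertices hides the bijection with
  \<open>{..<c}\<close>. Any \<open>c\<close> vertices of \<open>S\<close> serve as branch vertices,
  because the paths avoid all of \<open>S\<close> internally. The union of the chosen paths and
  vertices is minimal, as every subgraph carrying the same data contains it.\<close>

lemma contains_strong_immersionI:
  assumes G: "simple_graph G" and S: "S \<subseteq> verts G" "c \<le> card S"
    and path: "\<And>e. e \<subseteq> S \<Longrightarrow> card e = 2 \<Longrightarrow>
      path_in G (p e) \<and> {hd (p e), last (p e)} = e \<and> internal_vertices (p e) \<inter> S = {}"
    and disj: "disjoint_family_on (\<lambda>e. path_edges (p e)) {e. e \<subseteq> S \<and> card e = 2}"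
  shows "contains_strong_immersion G (complete_graph c)"
proof -
  obtain S' where S': "S' \<subseteq> S" "card S' = c" "finite S'"
    using obtain_subset_with_card_n[OF S(2)] by metis
  obtain \<iota> where \<iota>: "bij_betw \<iota> {..<c} S'"
    using finite_same_card_bij[of "{..<c}" S'] S' by auto
  let ?H = "complete_graph c"
  have vH: "verts ?H = {..<c}" and eH: "edges ?H = {e. e \<subseteq> {..<c} \<and> card e = 2}"
    unfolding complete_graph_def by simp_all
  have inj: "inj_on \<iota> {..<c}" and im: "\<iota> ` {..<c} = S'"
    using \<iota> unfolding bij_betw_def by auto
  define P where "P e = p (\<iota> ` e)" for e
  have e_im: "\<iota> ` e \<subseteq> S \<and> card (\<iota> ` e) = 2" if "e \<in> edges ?H" for e
    using that im S' inj unfolding eH by (auto simp: card_image inj_on_subset)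
  have P: "path_in G (P e)" "{hd (P e), last (P e)} = \<iota> ` e" "internal_vertices (P e) \<inter> S = {}"
    if "e \<in> edges ?H" for e
    using path[of "\<iota> ` e"] e_im[OF that] unfolding P_def by auto
  \<comment> \<open>The branch vertices are added separately because for \<open>c = 1\<close> no
    path contains them.\<close>
  define I where "I = \<lparr>verts = S' \<union> (\<Union>e\<in>edges ?H. set (P e)),
    edges = (\<Union>e\<in>edges ?H. path_edges (P e))\<rparr>"
  have finH: "finite (edges ?H)" unfolding eH by simp
  have "simple_graph I"
    unfolding simple_graph_def
  proof (intro conjI ballI)
    show "finite (verts I)" unfolding I_def using S' finH by simp
    fix f assume "f \<in> edges I"
    then obtain e where e: "e \<in> edges ?H" "f \<in> path_edges (P e)" unfolding I_def by auto
    then show "f \<subseteq> verts I" using path_edges_subset_set[OF e(2)] unfolding I_def by auto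
    show "card f = 2" using e P(1) G unfolding path_in_def simple_graph_def by blast
  qed
  moreover have "set (P e) \<subseteq> verts G" "path_edges (P e) \<subseteq> edges G" if "e \<in> edges ?H" for e
    using P(1)[OF that] unfolding path_in_def by auto
  then have "verts I \<subseteq> verts G" "edges I \<subseteq> edges G"
    unfolding I_def using S' S by (simp_all add: UN_least)
  ultimately have sub: "subgraph I G" unfolding subgraph_def by blast
  have "disjoint_family_on (\<lambda>e. path_edges (P e)) (edges ?H)"
    unfolding disjoint_family_on_def P_def
  proof (intro ballI impI)
    fix e f assume ef: "e \<in> edges ?H" "f \<in> edges ?H" "e \<noteq> f"
    then have "\<iota> ` e \<noteq> \<iota> ` f" using inj_on_image_eq_iff[OF inj] unfolding eH by blast
    then show "path_edges (p (\<iota> ` e)) \<inter> path_edges (p (\<iota> ` f)) = {}"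
      using disj e_im ef unfolding disjoint_family_on_def by blast
  qed
  then have model: "immersion_model ?H I \<iota> P"
    unfolding immersion_model_def using inj im P
    by (auto simp: vH I_def path_in_def)
  have "J = I" if J: "subgraph J I" "immersion_model ?H J \<iota> P" for J
  proof -
    have "S' \<subseteq> verts J" "\<forall>e\<in>edges ?H. path_in J (P e)"
      using J im unfolding immersion_model_def vH by auto
    then have "verts I \<subseteq> verts J" "edges I \<subseteq> edges J"
      unfolding I_def path_in_def by auto
    then show "J = I" using J(1) unfolding subgraph_def by simp
  qed
  then have "immersion ?H G I \<iota> P" unfolding immersion_def using sub model by blast
  moreover have "internal_vertices (P e) \<inter> \<iota> ` verts ?H = {}" if "e \<in> edges ?H" for e
    using P(3)[OF that] S' im unfolding vH by blast
  ultimately show ?thesis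
    unfolding contains_strong_immersion_def strong_immersion_def by blast
qed

text \<open>\<open>N y\<close> only has to contain the nonneighbours of \<open>y\<close>: it may also contain neighbours.\<close>

lemma routed_immersion:
  assumes G: "simple_graph G" and cliques: "clique G A" "clique G Y" "clique G C"
    and disjoint: "A \<inter> Y = {}" "A \<inter> C = {}" "Y \<inter> C = {}" and c: "c \<le> card (A \<union> Y)"
    and adjacent: "\<And>x y. x \<in> A \<Longrightarrow> y \<in> Y \<Longrightarrow> x \<notin> N y \<Longrightarrow> {x, y} \<in> edges G"
      "\<And>u y. u \<in> C \<Longrightarrow> y \<in> Y \<Longrightarrow> u \<notin> N y \<Longrightarrow> {u, y} \<in> edges G"
    and g: "inj_on g Y" "\<And>y. y \<in> Y \<Longrightarrow> g y \<in> C \<inter> N y"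
      "\<And>x y. y \<in> Y \<Longrightarrow> x \<in> A \<inter> N y \<Longrightarrow> {x, g y} \<in> edges G"
    and \<phi>: "\<And>y. y \<in> Y \<Longrightarrow> inj_on (\<phi> y) (A \<inter> N y)"
      "\<And>y. y \<in> Y \<Longrightarrow> \<phi> y ` (A \<inter> N y) \<subseteq> C - N y"
    and chain: "\<And>y z. y \<in> Y \<Longrightarrow> z \<in> Y \<Longrightarrow> C \<inter> N y \<subseteq> N z \<or> C \<inter> N z \<subseteq> N y"
  shows "contains_strong_immersion G (complete_graph c)"
proof -
  let ?S = "A \<union> Y"
  \<comment> \<open>These are relations because an unordered pair does not come with an orientation;
    a path for each pair is chosen afterwards.\<close>
  define direct where "direct e q \<longleftrightarrow> (\<exists>x y. x \<noteq> y \<and> e = {x, y} \<and> {x, y} \<in> edges G \<and> q = [x, y])" for e q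
  define routed where "routed e q \<longleftrightarrow>
    (\<exists>x\<in>A. \<exists>y\<in>Y. x \<in> N y \<and> x \<noteq> y \<and> e = {x, y} \<and> q = [x, g y, \<phi> y x, y])" for e q
  have "\<exists>q. direct e q \<or> routed e q" if e: "e \<subseteq> ?S" "card e = 2" for e
  proof (cases "e \<in> edges G")
    case True
    then show ?thesis using e(2) unfolding direct_def card_2_iff by blast
  next
    case False
    obtain x y where xy: "e = {x, y}" "x \<noteq> y" using e(2) unfolding card_2_iff by blast
    have "\<not> {x, y} \<subseteq> A" "\<not> {x, y} \<subseteq> Y"
      using False xy cliques unfolding clique_def by auto
    then have "x \<in> A \<and> y \<in> Y \<or> y \<in> A \<and> x \<in> Y" using xy e(1) by auto
    then obtain a b where ab: "e = {a, b}" "a \<in> A" "b \<in> Y" "a \<noteq> b"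
      using xy by (elim disjE conjE) (blast, metis insert_commute)
    then have "a \<in> N b" using adjacent(1) False by blast
    then show ?thesis using ab unfolding routed_def by blast
  qed
  then have "\<exists>p. \<forall>e. e \<subseteq> ?S \<and> card e = 2 \<longrightarrow> direct e (p e) \<or> routed e (p e)"
    by (intro choice) blast
  then obtain p where p: "\<And>e. e \<subseteq> ?S \<Longrightarrow> card e = 2 \<Longrightarrow> direct e (p e) \<or> routed e (p e)"
    by blast
  have S: "?S \<subseteq> verts G" and CV: "C \<subseteq> verts G" using cliques unfolding clique_def by auto
  have \<phi>C: "\<phi> y x \<in> C" "\<phi> y x \<notin> N y" if "y \<in> Y" "x \<in> A" "x \<in> N y" for x y
    using \<phi>(2)[OF that(1)] that by auto
  have gC: "g y \<in> C" "g y \<in> N y" if "y \<in> Y" for y using g(2)[OF that] by auto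
  have AYC: "x \<notin> C" if "x \<in> ?S" for x using that disjoint by blast
  have path: "path_in G (p e) \<and> {hd (p e), last (p e)} = e \<and> internal_vertices (p e) \<inter> ?S = {}"
    if e: "e \<subseteq> ?S" "card e = 2" for e
    using p[OF e]
  proof
    assume "direct e (p e)"
    then obtain x y where xy: "x \<noteq> y" "e = {x, y}" "{x, y} \<in> edges G" "p e = [x, y]"
      unfolding direct_def by blast
    then have "x \<in> verts G" "y \<in> verts G" using e(1) S by auto
    then show ?thesis using xy by (simp add: path_in_def internal_vertices_def path_edges_two)
  next
    assume "routed e (p e)"
    then obtain x y where xy: "x \<in> A" "y \<in> Y" "x \<in> N y" "x \<noteq> y" "e = {x, y}" "p e = [x, g y, \<phi> y x, y]"
      unfolding routed_def by blast
    note mem = gC[OF xy(2)] \<phi>C[OF xy(2,1,3)]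
    have neq: "g y \<noteq> \<phi> y x" using mem by metis
    then have edge: "{g y, \<phi> y x} \<in> edges G" using mem cliques(3) unfolding clique_def by blast
    have edge': "{x, g y} \<in> edges G" "{\<phi> y x, y} \<in> edges G"
      using g(3)[OF xy(2)] adjacent(2)[OF mem(3) xy(2) mem(4)] xy(1,3) by blast+
    have verts: "x \<in> verts G" "g y \<in> verts G" "\<phi> y x \<in> verts G" "y \<in> verts G"
      using xy(1,2) mem S CV by auto
    have notC: "x \<notin> C" "y \<notin> C" using xy(1,2) AYC by auto
    then have "distinct [x, g y, \<phi> y x, y]" using xy(4) mem neq by auto
    then have "path_in G (p e)"
      unfolding xy(6) path_in_def path_edges_four using edge edge' verts by simp
    moreover have "internal_vertices (p e) \<subseteq> C"
      unfolding xy(6) internal_vertices_def using mem by auto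
    ultimately show ?thesis using AYC xy(5,6) by auto
  qed
  have "path_edges (p e) \<inter> path_edges (p f) = {}"
    if e: "e \<subseteq> ?S" "card e = 2" and f: "f \<subseteq> ?S" "card f = 2" and "e \<noteq> f" for e f
  proof -
    have d: "path_edges q = {e'}" if "direct e' q" for e' q
      using that unfolding direct_def by (auto simp: path_edges_two)
    \<comment> \<open>Each edge of a routed path contains \<open>g y\<close> or
      \<open>\<phi> y x\<close>, hence a vertex of \<open>C\<close>, so it cannot be the single edge
      of a direct path.\<close>
    have r: "\<not> e' \<subseteq> ?S" if ro: "routed f' q" "e' \<in> path_edges q" for e' f' q
    proof -
      obtain x y where "x \<in> A" "y \<in> Y" "x \<in> N y" and q: "q = [x, g y, \<phi> y x, y]"
        using ro(1) unfolding routed_def by blast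
      then have "g y \<in> C" "\<phi> y x \<in> C" using gC \<phi>C by auto
      moreover have "g y \<in> e' \<or> \<phi> y x \<in> e'" using ro(2) unfolding q path_edges_four by auto
      ultimately show ?thesis using AYC by blast
    qed
    have rr: "path_edges q \<inter> path_edges r = {}" if q: "routed e q" and r: "routed f r" for q r
    proof -
      obtain x y where xy: "x \<in> A" "y \<in> Y" "x \<in> N y" "e = {x, y}" "q = [x, g y, \<phi> y x, y]"
        using q unfolding routed_def by blast
      obtain x' y' where xy': "x' \<in> A" "y' \<in> Y" "x' \<in> N y'" "f = {x', y'}" "r = [x', g y', \<phi> y' x', y']"
        using r unfolding routed_def by blast
      note mem = gC[OF xy(2)] \<phi>C[OF xy(2,1,3)] gC[OF xy'(2)] \<phi>C[OF xy'(2,1,3)]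
        AYC[of x] AYC[of y] AYC[of x'] AYC[of y']
      have neq: "\<not> (x = x' \<and> y = y')" using \<open>e \<noteq> f\<close> xy xy' by auto
      have same_y: "y \<noteq> y'" if "\<phi> y x = \<phi> y' x'"
        using \<phi>(1)[OF xy(2)] that neq xy xy' unfolding inj_on_def by blast
      have g_inj: "y = y'" if "g y = g y'" using g(1) that xy xy' unfolding inj_on_def by blast
      \<comment> \<open>Equal middle edges with crossed ends would put \<open>g y\<close> in
        \<open>N y\<close> but not in \<open>N y'\<close>, and \<open>g y'\<close> in
        \<open>N y'\<close> but not in \<open>N y\<close>, against the chain condition.\<close>
      have cross: "\<not> (g y = \<phi> y' x' \<and> \<phi> y x = g y')"
        using chain[OF xy(2) xy'(2)] mem by auto
      have "{x, g y} \<noteq> {x', g y'}" using mem neq g_inj xy xy' by (auto simp: doubleton_eq_iff)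
      moreover have "{x, g y} \<noteq> {g y', \<phi> y' x'}" "{x', g y'} \<noteq> {g y, \<phi> y x}"
        using mem xy xy' by (auto simp: doubleton_eq_iff)
      moreover have "{x, g y} \<noteq> {\<phi> y' x', y'}" "{x', g y'} \<noteq> {\<phi> y x, y}"
        using mem xy(1,2) xy'(1,2) disjoint(1) by (auto simp: doubleton_eq_iff)
      moreover have "{g y, \<phi> y x} \<noteq> {g y', \<phi> y' x'}"
        using same_y g_inj cross by (auto simp: doubleton_eq_iff)
      moreover have "{g y, \<phi> y x} \<noteq> {\<phi> y' x', y'}" "{g y', \<phi> y' x'} \<noteq> {\<phi> y x, y}"
        using mem xy xy' by (auto simp: doubleton_eq_iff)
      moreover have "{\<phi> y x, y} \<noteq> {\<phi> y' x', y'}"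
        using mem xy xy' same_y by (auto simp: doubleton_eq_iff)
      ultimately show ?thesis unfolding xy(5) xy'(5) path_edges_four by auto
    qed
    show ?thesis
      using p[OF e] p[OF f]
    proof (elim disjE)
      assume "direct e (p e)" "direct f (p f)"
      then show ?thesis using d \<open>e \<noteq> f\<close> by simp
    next
      assume "direct e (p e)" "routed f (p f)"
      then show ?thesis using d r e(1) by fastforce
    next
      assume "routed e (p e)" "direct f (p f)"
      then show ?thesis using d r f(1) by fastforce
    next
      assume "routed e (p e)" "routed f (p f)"
      then show ?thesis by (rule rr)
    qed
  qed
  then have "disjoint_family_on (\<lambda>e. path_edges (p e)) {e. e \<subseteq> ?S \<and> card e = 2}"
    unfolding disjoint_family_on_def by blast
  then show ?thesis using contains_strong_immersionI[OF G S c path] by blast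
qed

subsection \<open>Colourings, degrees and clique covers\<close>

text \<open>The vertices outside \<open>X\<close> get distinct colours, and each \<open>x\<close> in
  \<open>X\<close> copies the colour of its nonneighbour \<open>g x\<close>. As \<open>g\<close> is
  injective, a colour class has at most two vertices.\<close>

lemma chromatic_number_le_matching:
  assumes G: "simple_graph G" and X: "X \<subseteq> verts G" "inj_on g X"
    and g: "\<And>x. x \<in> X \<Longrightarrow> g x \<in> verts G - X \<and> {x, g x} \<notin> edges G"
  shows "chromatic_number G \<le> card (verts G - X)"
proof -
  let ?R = "verts G - X"
  have "finite ?R" using G unfolding simple_graph_def by blast
  then obtain h where h: "bij_betw h ?R {..<card ?R}"
    using finite_same_card_bij[of ?R "{..<card ?R}"] by auto
  then have inj_h: "inj_on h ?R" by (rule bij_betw_imp_inj_on)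
  define col where "col x = h (if x \<in> X then g x else x)" for x
  have "proper_coloring G (card ?R) col"
    unfolding proper_coloring_def
  proof (intro conjI allI impI)
    show "col ` verts G \<subseteq> {..<card ?R}"
    proof (rule image_subsetI)
      fix v assume "v \<in> verts G"
      then have "(if v \<in> X then g v else v) \<in> ?R" using g by auto
      then show "col v \<in> {..<card ?R}" unfolding col_def using bij_betwE[OF h] by blast
    qed
    fix u v assume uv: "{u, v} \<in> edges G"
    then have V: "u \<in> verts G" "v \<in> verts G" and "card {u, v} = 2"
      using G unfolding simple_graph_def by auto
    then have "u \<noteq> v" by auto
    have "(if u \<in> X then g u else u) \<noteq> (if v \<in> X then g v else v)"
      using g[of u] g[of v] uv \<open>u \<noteq> v\<close> X(2) by (auto simp: inj_on_def insert_commute)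
    moreover have "(if u \<in> X then g u else u) \<in> ?R" "(if v \<in> X then g v else v) \<in> ?R"
      using g V by auto
    ultimately show "col u \<noteq> col v" using inj_h unfolding col_def inj_on_def by blast
  qed
  then show ?thesis unfolding chromatic_number_def by (intro Least_le) blast
qed

lemma independent_card_le:
  assumes "simple_graph G" "independent G S"
  shows "card S \<le> independence_number G"
proof -
  have "finite (verts G)" using assms unfolding simple_graph_def by blast
  moreover have "{card S | S. independent G S} \<subseteq> card ` Pow (verts G)"
    unfolding independent_def by blast
  ultimately have "finite {card S | S. independent G S}" by (meson finite_Pow_iff finite_imageI finite_subset)
  then show ?thesis unfolding independence_number_def using assms by (intro Max_ge) auto
qed

lemma degree_eq_card_nbrs:
  assumes "simple_graph G"
  shows "degree G v = card {w. {v, w} \<in> edges G}"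
proof -
  have e: "e \<in> edges G \<Longrightarrow> card e = 2" for e using assms unfolding simple_graph_def by blast
  have "{e \<in> edges G. v \<in> e} = (\<lambda>w. {v, w}) ` {w. {v, w} \<in> edges G}"
  proof
    show "{e \<in> edges G. v \<in> e} \<subseteq> (\<lambda>w. {v, w}) ` {w. {v, w} \<in> edges G}"
    proof
      fix e assume "e \<in> {e \<in> edges G. v \<in> e}"
      then obtain x y where "e = {x, y}" "v \<in> {x, y}" "e \<in> edges G"
        using e[of e] unfolding card_2_iff by auto
      then show "e \<in> (\<lambda>w. {v, w}) ` {w. {v, w} \<in> edges G}"
        by (cases "v = x") (auto simp: insert_commute)
    qed
  qed auto
  moreover have "inj_on (\<lambda>w. {v, w}) {w. {v, w} \<in> edges G}"
    by (auto simp: inj_on_def doubleton_eq_iff)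
  ultimately show ?thesis unfolding degree_def by (simp add: card_image)
qed

lemma three_cliques:
  assumes "clique_covering_number G \<le> 3" "finite (verts G)"
  shows "\<exists>A B C. A \<union> B \<union> C = verts G \<and> A \<inter> B = {} \<and> A \<inter> C = {} \<and> B \<inter> C = {} \<and>
    clique G A \<and> clique G B \<and> clique G C"
proof -
  let ?P = "\<lambda>k. \<exists>\<C>. partition_on (verts G) \<C> \<and> (\<forall>C\<in>\<C>. clique G C) \<and> card \<C> = k"
  \<comment> \<open>The partition into singletons is a witness that the \<open>LEAST\<close> is
    attained.\<close>
  have "partition_on (verts G) ((\<lambda>x. {x}) ` verts G)"
    by (auto simp: partition_on_def disjoint_def)
  moreover have "\<forall>C\<in>(\<lambda>x. {x}) ` verts G. clique G C" unfolding clique_def by auto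
  ultimately have "?P (card ((\<lambda>x. {x}) ` verts G))" by blast
  then have "?P (clique_covering_number G)" unfolding clique_covering_number_def by (rule LeastI)
  then obtain \<C> where \<C>: "partition_on (verts G) \<C>" "\<forall>C\<in>\<C>. clique G C" "card \<C> \<le> 3"
    using assms(1) by auto
  have "finite \<C>" using finite_elements[OF assms(2) \<C>(1)] .
  then obtain h where h: "bij_betw h {0..<card \<C>} \<C>" using ex_bij_betw_nat_finite by blast
  \<comment> \<open>Parts of a partition are nonempty, so a cover by fewer than three cliques is
    padded with empty sets.\<close>
  define D where "D i = (if i < card \<C> then h i else {})" for i
  have D: "clique G (D i)" for i
  proof (cases "i < card \<C>")
    case True
    then have "h i \<in> \<C>" using bij_betwE[OF h] by simp
    then show ?thesis using \<C>(2) True unfolding D_def by simp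
  qed (simp add: D_def clique_def)
  have "D i \<inter> D j = {}" if "i \<noteq> j" for i j
  proof (cases "i < card \<C> \<and> j < card \<C>")
    case True
    then have "h i \<in> \<C>" "h j \<in> \<C>" using bij_betwE[OF h] by simp_all
    moreover have "h i \<noteq> h j"
      using True that bij_betw_imp_inj_on[OF h] by (simp add: inj_on_eq_iff)
    ultimately have "h i \<inter> h j = {}" using partition_onD2[OF \<C>(1)] by (auto dest: disjointD)
    then show ?thesis using True unfolding D_def by simp
  qed (auto simp: D_def)
  moreover have "D 0 \<union> D 1 \<union> D 2 = verts G"
  proof -
    have "verts G = \<Union>(h ` {0..<card \<C>})"
      using partition_onD1[OF \<C>(1)] bij_betw_imp_surj_on[OF h] by simp
    also have "\<dots> = \<Union>(D ` {0..<card \<C>})" unfolding D_def by simp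
    also have "\<dots> = \<Union>(D ` {0..<3})"
    proof
      show "\<Union>(D ` {0..<card \<C>}) \<subseteq> \<Union>(D ` {0..<3})"
        using \<C>(3) by (intro Union_mono image_mono) simp
      show "\<Union>(D ` {0..<3}) \<subseteq> \<Union>(D ` {0..<card \<C>})"
      proof (rule UN_least)
        fix i show "D i \<subseteq> \<Union>(D ` {0..<card \<C>})"
          by (cases "i < card \<C>") (blast intro: atLeastLessThan_iff[THEN iffD2], simp add: D_def)
      qed
    qed
    also have "{0..<3::nat} = {0, 1, 2}" by auto
    finally show ?thesis by auto
  qed
  ultimately show ?thesis using D by (intro exI[of _ "D 0"] exI[of _ "D 1"] exI[of _ "D 2"]) simp
qed

section \<open>Passage to the complement and the two cases for its stability number\<close>

theorem theorem7:
  fixes G :: "'a sgraph" and n :: nat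
  assumes "simple_graph G"
    and "card (verts G) = n"
    and "independence_number G = 2"
    and "clique_covering_number G \<le> 3"
    and "real (max_degree G) < 2 * real n / 3 - 1"
  shows "contains_strong_immersion G (complete_graph (chromatic_number G))"
proof -
  note G = assms(1)
  define V where "V = verts G"
  define E where "E = {(u, v). u \<in> V \<and> v \<in> V \<and> u \<noteq> v \<and> {u, v} \<notin> edges G}"
  have finV: "finite V" and edge2: "\<And>e. e \<in> edges G \<Longrightarrow> e \<subseteq> V \<and> card e = 2"
    using G unfolding simple_graph_def V_def by auto
  have clique_iff: "clique G S \<longleftrightarrow> stable E S" if "S \<subseteq> V" for S
    using that unfolding clique_def stable_def E_def V_def by auto
  have "triangle_free E"
    unfolding triangle_free_def
  proof (intro allI impI notI)
    fix x y z assume e: "(x, y) \<in> E" "(y, z) \<in> E" "(x, z) \<in> E"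
    \<comment> \<open>\<open>independent\<close> also tests equal vertices, so singletons have to be
      excluded as edges.\<close>
    have "{w} \<notin> edges G" for w using edge2[of "{w}"] by auto
    then have "independent G {x, y, z}"
      using e unfolding independent_def E_def V_def by (auto simp: insert_commute)
    moreover have "card {x, y, z} = 3" using e unfolding E_def by auto
    ultimately show False using independent_card_le[OF G] assms(3) by fastforce
  qed
  moreover have "card V < 3 * card (E `` {v})" if v: "v \<in> V" for v
  proof -
    let ?D = "{w. {v, w} \<in> edges G}"
    have D: "?D \<subseteq> V - {v}" using edge2 by fastforce
    have "E `` {v} = (V - {v}) - ?D" unfolding E_def using v by auto
    then have "card (E `` {v}) = card (V - {v}) - card ?D"
      using D finV by (simp add: card_Diff_subset finite_subset)
    moreover have "card (V - {v}) = n - 1" using v finV assms(2) unfolding V_def by simp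
    moreover have "card ?D = degree G v" using degree_eq_card_nbrs[OF G] by simp
    moreover have "degree G v \<le> max_degree G"
      unfolding max_degree_def using v finV unfolding V_def by (intro Max_ge) auto
    \<comment> \<open>Complementary degrees are \<open>n - 1 - degree G v\<close>, and three times
      this exceeds \<open>n\<close> by the degree bound.\<close>
    moreover have "3 * max_degree G + 3 < 2 * n" using assms(5) by (simp add: field_simps)
    ultimately show ?thesis using assms(2) unfolding V_def by linarith
  qed
  ultimately interpret dense_triangle_free V E
    using finV by unfold_locales (auto simp: E_def sym_def insert_commute)
  have "\<exists>I. (I \<subseteq> V \<and> stable E I) \<and> (\<forall>J. J \<subseteq> V \<and> stable E J \<longrightarrow> card J \<le> card I)"
    using finV by (intro ex_has_greatest_nat[where k = "{}" and b = "Suc (card V)"])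
      (auto simp: stable_def less_Suc_eq_le card_mono)
  then obtain I where I: "I \<subseteq> V" "stable E I"
    and I_max: "\<And>J. J \<subseteq> V \<Longrightarrow> stable E J \<Longrightarrow> card J \<le> card I" by blast
  have I_le: "card I \<le> card V" using I finV by (intro card_mono)
  show ?thesis
  proof (cases "card V \<le> 2 * card I")
    case True
    obtain g where "inj_on g (V - I)" "\<forall>x\<in>V - I. g x \<in> I \<and> (x, g x) \<in> E"
      using matching_into_maximum_stable[OF I I_max True] by blast
    then have "chromatic_number G \<le> card (V - (V - I))"
      unfolding V_def using I by (intro chromatic_number_le_matching[OF G]) (auto simp: E_def V_def)
    moreover have "V - (V - I) = I" using I by blast
    \<comment> \<open>The clique \<open>I\<close> is treated as a routed immersion in which
      \<open>Y\<close> and \<open>C\<close> are empty.\<close>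
    ultimately have "chromatic_number G \<le> card (I \<union> {})" by simp
    moreover have "clique G I" "clique G {}" using clique_iff[OF I(1)] I unfolding clique_def by auto
    ultimately show ?thesis
      by (intro routed_immersion[OF G, where A = I and Y = "{}" and C = "{}"]) auto
  next
    case False
    then have le: "2 * card I \<le> card V" by simp
    obtain g where g: "inj_on g I" "\<forall>x\<in>I. (x, g x) \<in> E"
      using matching_from_maximum_stable[OF I I_max le] by blast
    then have "g x \<in> V - I \<and> {x, g x} \<notin> edges G" if "x \<in> I" for x
      using I that unfolding E_def stable_def by blast
    then have "chromatic_number G \<le> card (V - I)"
      unfolding V_def using I g unfolding V_def by (intro chromatic_number_le_matching[OF G]) auto
    then have \<chi>: "chromatic_number G \<le> card V - card I"
      using I finV by (simp add: card_Diff_subset finite_subset)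
    obtain A\<^sub>0 B\<^sub>0 C\<^sub>0 where cover: "A\<^sub>0 \<union> B\<^sub>0 \<union> C\<^sub>0 = V"
      "A\<^sub>0 \<inter> B\<^sub>0 = {}" "A\<^sub>0 \<inter> C\<^sub>0 = {}" "B\<^sub>0 \<inter> C\<^sub>0 = {}"
      "clique G A\<^sub>0" "clique G B\<^sub>0" "clique G C\<^sub>0"
      using three_cliques[OF assms(4)] finV unfolding V_def by blast
    then have "A\<^sub>0 \<subseteq> V" "B\<^sub>0 \<subseteq> V" "C\<^sub>0 \<subseteq> V" by auto
    then have "tripartition E V A\<^sub>0 B\<^sub>0 C\<^sub>0"
      using cover clique_iff unfolding tripartition_def by simp
    \<comment> \<open>The largest third part is chosen for \<open>E\<close>, before the graph is
      enlarged.\<close>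
    then have "\<exists>p. (case p of (A, B, C) \<Rightarrow> tripartition E V A B C) \<and>
      (\<forall>q. (case q of (A, B, C) \<Rightarrow> tripartition E V A B C) \<longrightarrow> card (snd (snd q)) \<le> card (snd (snd p)))"
      using finV by (intro ex_has_greatest_nat[where k = "(A\<^sub>0, B\<^sub>0, C\<^sub>0)" and b = "Suc (card V)"])
        (auto simp: tripartition_def less_Suc_eq_le intro!: card_mono)
    then obtain A B C where part: "tripartition E V A B C"
      and C_max: "\<And>A' B' C'. tripartition E V A' B' C' \<Longrightarrow> card C' \<le> card C"
      by (auto simp: split_paired_all)
    obtain F where F: "E \<subseteq> F" "F \<subseteq> V \<times> V" "sym F" "triangle_free F" "tripartition F V A B C"
      and sat: "\<forall>x\<in>B. \<forall>y\<in>A \<union> C. (x, y) \<notin> F \<longrightarrow> (\<exists>z. (x, z) \<in> F \<and> (z, y) \<in> F)"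
      using saturated_extension[OF finV E_subset sym_E triangle_free_E part] by blast
    have "card V < 3 * card (F `` {v})" if "v \<in> V" for v
    proof -
      have "card (E `` {v}) \<le> card (F `` {v})"
        using F(1,2) finV by (intro card_mono) (auto intro: finite_subset[of _ V])
      then show ?thesis using dense[OF that] by linarith
    qed
    then interpret F: saturated_tripartite V F A B C
      using finV F sat by unfold_locales auto
    have stable_F: "stable E J" if "stable F J" for J
      using that F(1) unfolding stable_def by blast
    \<comment> \<open>Sets stable in \<open>F\<close> are stable in \<open>E\<close>, so the
      extremal choices of \<open>C\<close> and \<open>I\<close> remain valid bounds for
      \<open>F\<close>.\<close>
    have "card C' \<le> card C" if "tripartition F V A' B' C'" for A' B' C'
      using that C_max[of A' B' C'] stable_F unfolding tripartition_def by simp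
    moreover have "card J \<le> card I" if "J \<subseteq> V" "stable F J" for J
      using that I_max stable_F by blast
    moreover have "card A \<le> card I"
      using I_max[of A] part unfolding tripartition_def by blast
    then have "card A \<le> card V - card I" using le by linarith
    ultimately have "\<exists>Y g \<phi>. Y \<subseteq> B \<and> card (A \<union> Y) = card V - card I \<and> inj_on g Y \<and>
      (\<forall>y\<in>Y. g y \<in> C \<inter> F `` {y}) \<and>
      (\<forall>y\<in>Y. inj_on (\<phi> y) (A \<inter> F `` {y}) \<and> \<phi> y ` (A \<inter> F `` {y}) \<subseteq> C - F `` {y})"
      using I_le by (intro F.routing_data[of "card I"]) simp_all
    then obtain Y h \<phi> where Y: "Y \<subseteq> B" "card (A \<union> Y) = card V - card I"
      and h: "inj_on h Y" "\<forall>y\<in>Y. h y \<in> C \<inter> F `` {y}"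
      and \<phi>: "\<forall>y\<in>Y. inj_on (\<phi> y) (A \<inter> F `` {y}) \<and> \<phi> y ` (A \<inter> F `` {y}) \<subseteq> C - F `` {y}"
      by blast
    have sub: "A \<subseteq> V" "Y \<subseteq> V" "C \<subseteq> V" using F.V_eq Y by auto
    \<comment> \<open>Only one direction is available: since \<open>F\<close> may properly contain
      \<open>E\<close>, vertices adjacent in \<open>F\<close> may be adjacent in \<open>G\<close>
      too.\<close>
    have adj: "{x, y} \<in> edges G" if "x \<in> V" "y \<in> V" "x \<noteq> y" "(y, x) \<notin> F" for x y
      using that F(1) unfolding E_def by (auto simp: insert_commute)
    have cliques: "clique G A" "clique G Y" "clique G C"
      using sub clique_iff part stable_mono[OF _ Y(1)] unfolding tripartition_def by auto
    have disj: "A \<inter> Y = {}" "A \<inter> C = {}" "Y \<inter> C = {}" using F.disjoint_parts Y by auto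
    show ?thesis
    proof (rule routed_immersion[OF G cliques disj, where N = "\<lambda>y. F `` {y}" and g = h and \<phi> = \<phi>])
      show "chromatic_number G \<le> card (A \<union> Y)" using \<chi> Y by simp
      show "{x, y} \<in> edges G" if "x \<in> A" "y \<in> Y" "x \<notin> F `` {y}" for x y
        using adj[of x y] that sub disj by blast
      show "{u, y} \<in> edges G" if "u \<in> C" "y \<in> Y" "u \<notin> F `` {y}" for u y
        using adj[of u y] that sub disj by blast
      \<comment> \<open>Both \<open>x\<close> and \<open>h y\<close> are neighbours of
        \<open>y\<close> in the triangle-free \<open>F\<close>, hence nonadjacent in
        \<open>F\<close> and adjacent in \<open>G\<close>.\<close>
      show "{x, h y} \<in> edges G" if "y \<in> Y" "x \<in> A \<inter> F `` {y}" for x y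
      proof (rule adj)
        show "x \<in> V" "h y \<in> V" "x \<noteq> h y" using h(2) that sub disj by auto
        show "(h y, x) \<notin> F"
          using h(2) that F.no_triangle[of "h y" y x] F.no_triangle[of y "h y" x] by auto
      qed
      show "C \<inter> F `` {y} \<subseteq> F `` {z} \<or> C \<inter> F `` {z} \<subseteq> F `` {y}" if "y \<in> Y" "z \<in> Y" for y z
        using F.nbrs_chain that Y(1) by blast
    qed (use h \<phi> in auto)
  qed
qed

end
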